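(* Let $n\ge 1$, let $A$ be an MR-subalgebra of $\mathcal L_n$ with type $\langle t_i\mid 1\le i\le n\rangle$, and put $r=\sum_{i=1}^n i\,t_i$. Then the group $\mathrm{Fr}(A)=\{\varphi\in\mathrm{Aut}(\mathcal L_n)\mid \varphi(x)=x\text{ for all }x\in A\}$ has order $$|\mathrm{Fr}(A)|=2^{\,n-r}\,(n-r)!\,\prod_{i=1}^{n}(i!)^{t_i}.$$
   Context: $\mathcal L_n$ is the face poset of the $n$-cube, represented as the set of signed subsets of $\{1,\dots,n\}$: pairs $(X_1,X_2)$ with $X_1,X_2\subseteq\{1,\dots,n\}$, $X_1\cap X_2=\emptyset$, ordered by $(X_1,X_2)\le(Y_1,Y_2)$ iff $Y_1\subseteq X_1$ and $Y_2\subseteq X_2$. It has maximum $\mathbf 1=(\emptyset,\emptyset)$ and joins (componentwise intersection). For $y=(Y_1,Y_2)\le x=(X_1,X_2)$ put $\Delta(x,y)=(X_1\cup(Y_2\setminus X_2),\,X_2\cup(Y_1\setminus X_1))$ (reflection of $y$ through the centre of $x$). The caret operation $x\mathbin{\hat{}}y=x\wedge\Delta(x\vee y,y)$ is always defined. An MR-subalgebra of $\mathcal L_n$ is a subset containing $\mathbf 1$ and closed under $\vee$, under $\Delta(x,y)$ for $y\le x$, and under caret. $\mathrm{Aut}(\mathcal L_n)$ is the group of bijections of $\mathcal L_n$ preserving $\le$ in both directions and $\Delta$. Type: the coatoms of $A$ are the maximal elements of $A\setminus\{\mathbf 1\}$. For a coatom $a$ of $A$, $\mathscr C_a$ is the set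 of coatoms $c$ of $\mathcal L_n$ with $a\le c$. For each $1\le i\le n$ the number of coatoms $a$ of $A$ with $|\mathscr C_a|=i$ is even, and $t_i$ is defined by $2t_i=|\{a \text{ a coatom of }A: |\mathscr C_a|=i\}|$. The type of $A$ is $\langle t_i\mid 1\le i\le n\rangle$. *)

theory Defs
  imports "HOL-Algebra.Bij" "HOL-Algebra.Coset"
begin

section \<open>The face poset of the cube\<close>

type_synonym signed_set = "nat set \<times> nat set"

definition cube :: "nat \<Rightarrow> signed_set set" where
  "cube n = {(X1, X2). X1 \<subseteq> {1..n} \<and> X2 \<subseteq> {1..n} \<and> X1 \<inter> X2 = {}}"

text \<open>The order is reverse inclusion in both components, so it is \<^emph>\<open>not\<close> the product order
  on pairs; joins are intersections, and meets (where they exist) are unions.\<close>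

definition cle :: "signed_set \<Rightarrow> signed_set \<Rightarrow> bool" (infix "\<preceq>" 50) where
  "X \<preceq> Y \<longleftrightarrow> fst Y \<subseteq> fst X \<and> snd Y \<subseteq> snd X"

definition ctop :: signed_set where
  "ctop = ({}, {})"

definition cjoin :: "signed_set \<Rightarrow> signed_set \<Rightarrow> signed_set" where
  "cjoin X Y = (fst X \<inter> fst Y, snd X \<inter> snd Y)"

definition cmeet :: "signed_set \<Rightarrow> signed_set \<Rightarrow> signed_set" where
  "cmeet X Y = (fst X \<union> fst Y, snd X \<union> snd Y)"

text \<open>\<open>Delta x y\<close> is only meaningful for \<open>y \<preceq> x\<close>.\<close>

definition Delta :: "signed_set \<Rightarrow> signed_set \<Rightarrow> signed_set" where
  "Delta x y = (fst x \<union> (snd y - snd x), snd x \<union> (fst y - fst x))"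

definition caret :: "signed_set \<Rightarrow> signed_set \<Rightarrow> signed_set" where
  "caret x y = cmeet x (Delta (cjoin x y) y)"

lemmas cube_simps = cube_def cle_def ctop_def cjoin_def cmeet_def Delta_def caret_def

lemma ctop_in_cube: "ctop \<in> cube n"
  by (auto simp: cube_simps)

lemma cle_ctop: "x \<preceq> ctop"
  by (auto simp: cube_simps)

lemma cle_antisym: "x \<preceq> y \<Longrightarrow> y \<preceq> x \<Longrightarrow> x = y"
  by (auto simp: cle_def prod_eq_iff)

lemma cjoin_lub:
  assumes "x \<in> cube n" "y \<in> cube n"
  shows "cjoin x y \<in> cube n" "x \<preceq> cjoin x y" "y \<preceq> cjoin x y"
    "\<And>z. x \<preceq> z \<Longrightarrow> y \<preceq> z \<Longrightarrow> cjoin x y \<preceq> z"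
  using assms by (auto simp: cube_simps)

lemma cmeet_glb:
  shows "cmeet x y \<preceq> x" "cmeet x y \<preceq> y" "\<And>z. z \<preceq> x \<Longrightarrow> z \<preceq> y \<Longrightarrow> z \<preceq> cmeet x y"
  by (auto simp: cube_simps)

lemma cmeet_in_cube_iff:
  assumes "x \<in> cube n" "y \<in> cube n"
  shows "cmeet x y \<in> cube n \<longleftrightarrow> (\<exists>z\<in>cube n. z \<preceq> x \<and> z \<preceq> y)"
proof
  assume "\<exists>z\<in>cube n. z \<preceq> x \<and> z \<preceq> y"
  then show "cmeet x y \<in> cube n" using assms by (auto simp: cube_simps)
qed (use cmeet_glb in blast)

lemma Delta_in_cube:
  "x \<in> cube n \<Longrightarrow> y \<in> cube n \<Longrightarrow> y \<preceq> x \<Longrightarrow> Delta x y \<in> cube n"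
  by (auto simp: cube_simps)

lemma caret_in_cube:
  "x \<in> cube n \<Longrightarrow> y \<in> cube n \<Longrightarrow> caret x y \<in> cube n"
  by (auto simp: cube_simps)


section \<open>MR-subalgebras and their type\<close>

definition MR_subalgebra :: "nat \<Rightarrow> signed_set set \<Rightarrow> bool" where
  "MR_subalgebra n A \<longleftrightarrow>
     A \<subseteq> cube n \<and> ctop \<in> A \<and>
     (\<forall>x\<in>A. \<forall>y\<in>A. cjoin x y \<in> A) \<and>
     (\<forall>x\<in>A. \<forall>y\<in>A. y \<preceq> x \<longrightarrow> Delta x y \<in> A) \<and>
     (\<forall>x\<in>A. \<forall>y\<in>A. caret x y \<in> A)"

definition coatoms :: "signed_set set \<Rightarrow> signed_set set" where
  "coatoms S = {a \<in> S - {ctop}. \<forall>b \<in> S - {ctop}. a \<preceq> b \<longrightarrow> b = a}"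

definition coatoms_above :: "nat \<Rightarrow> signed_set \<Rightarrow> signed_set set" where
  "coatoms_above n a = {c \<in> coatoms (cube n). a \<preceq> c}"

text \<open>Only the values \<open>t i\<close> with \<open>1 \<le> i \<le> n\<close> matter.\<close>

definition has_type :: "nat \<Rightarrow> signed_set set \<Rightarrow> (nat \<Rightarrow> nat) \<Rightarrow> bool" where
  "has_type n A t \<longleftrightarrow>
     (\<forall>i\<in>{1..n}. 2 * t i = card {a \<in> coatoms A. card (coatoms_above n a) = i})"


section \<open>Automorphisms\<close>

definition Aut :: "nat \<Rightarrow> (signed_set \<Rightarrow> signed_set) set" where
  "Aut n = {\<phi> \<in> Bij (cube n).
     (\<forall>x\<in>cube n. \<forall>y\<in>cube n. \<phi> x \<preceq> \<phi> y \<longleftrightarrow> x \<preceq> y) \<and>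
     (\<forall>x\<in>cube n. \<forall>y\<in>cube n. y \<preceq> x \<longrightarrow> \<phi> (Delta x y) = Delta (\<phi> x) (\<phi> y))}"

definition AutGroup :: "nat \<Rightarrow> (signed_set \<Rightarrow> signed_set) monoid" where
  "AutGroup n = (BijGroup (cube n))\<lparr>carrier := Aut n\<rparr>"

definition Fr :: "nat \<Rightarrow> signed_set set \<Rightarrow> (signed_set \<Rightarrow> signed_set) monoid" where
  "Fr n A = (AutGroup n)\<lparr>carrier := {\<phi> \<in> Aut n. \<forall>x\<in>A. \<phi> x = x}\<rparr>"


section \<open>Well-definedness\<close>

subsection \<open>The two groups\<close>

lemma Fr_subgroup_aux:
  assumes A: "A \<subseteq> cube n"
  shows "subgroup {\<phi> \<in> Aut n. \<forall>x\<in>A. \<phi> x = x} (BijGroup (cube n))"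
    (is "subgroup ?H ?G")
proof -
  interpret group ?G by (rule group_BijGroup)
  have BijH: "?H \<subseteq> Bij (cube n)" by (auto simp: Aut_def)
  have mem: "f x \<in> cube n" if "f \<in> Bij (cube n)" "x \<in> cube n" for f x
    using Bij_imp_funcset[OF that(1)] that(2) by auto
  show ?thesis
  proof (rule subgroupI)
    show "?H \<subseteq> carrier ?G" using BijH by (simp add: BijGroup_def)
    have "(\<lambda>x\<in>cube n. x) \<in> ?H"
      using A by (auto simp: Aut_def id_Bij Delta_in_cube)
    then show "?H \<noteq> {}" by blast
  next
    fix f assume f: "f \<in> ?H"
    then have fB: "f \<in> Bij (cube n)" by (auto simp: Aut_def)
    define g where "g = (\<lambda>x\<in>cube n. inv_into (cube n) f x)"
    have gB: "g \<in> Bij (cube n)" unfolding g_def by (rule restrict_inv_into_Bij[OF fB])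
    have fg: "f (g x) = x" if "x \<in> cube n" for x
      using fB that by (simp add: g_def Bij_def bij_betw_def f_inv_into_f)
    have gf: "g (f x) = x" if "x \<in> cube n" for x
      using fB that mem[OF fB that] by (simp add: g_def Bij_def bij_betw_def inv_into_f_f)
    have inv: "inv\<^bsub>?G\<^esub> f = g" using fB by (simp add: g_def inv_BijGroup)
    have ord: "g x \<preceq> g y \<longleftrightarrow> x \<preceq> y" if "x \<in> cube n" "y \<in> cube n" for x y
    proof -
      have "f (g x) \<preceq> f (g y) \<longleftrightarrow> g x \<preceq> g y"
        using f mem[OF gB] that by (auto simp: Aut_def)
      then show ?thesis using fg that by simp
    qed
    have del: "g (Delta x y) = Delta (g x) (g y)"
      if xy: "x \<in> cube n" "y \<in> cube n" "y \<preceq> x" for x y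
    proof -
      have m: "g x \<in> cube n" "g y \<in> cube n" "g y \<preceq> g x"
        using xy mem[OF gB] ord by auto
      then have "f (Delta (g x) (g y)) = Delta (f (g x)) (f (g y))"
        using f by (auto simp: Aut_def)
      then have "f (Delta (g x) (g y)) = Delta x y" using fg xy by simp
      then show ?thesis using gf Delta_in_cube[OF m] by metis
    qed
    have "g x = x" if "x \<in> A" for x
    proof -
      have "f x = x" using f that by blast
      then show ?thesis using gf[of x] A that by auto
    qed
    then show "inv\<^bsub>?G\<^esub> f \<in> ?H"
      unfolding inv using gB ord del by (auto simp: Aut_def)
  next
    fix f g assume f: "f \<in> ?H" and g: "g \<in> ?H"
    then have B: "f \<in> Bij (cube n)" "g \<in> Bij (cube n)" by (auto simp: Aut_def)
    have "f \<otimes>\<^bsub>?G\<^esub> g = compose (cube n) f g" using B by (simp add: BijGroup_def)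
    moreover have "compose (cube n) f g \<in> ?H"
    proof -
      have o: "f (g x) \<preceq> f (g y) \<longleftrightarrow> x \<preceq> y" if "x \<in> cube n" "y \<in> cube n" for x y
        using f g mem[OF B(2)] that by (auto simp: Aut_def)
      have d: "f (g (Delta x y)) = Delta (f (g x)) (f (g y))"
        if "x \<in> cube n" "y \<in> cube n" "y \<preceq> x" for x y
        using f g mem[OF B(2)] that by (auto simp: Aut_def)
      show ?thesis
        using f g A compose_Bij[OF B] o d
        by (auto simp: Aut_def compose_eq Delta_in_cube subset_iff)
    qed
    ultimately show "f \<otimes>\<^bsub>?G\<^esub> g \<in> ?H" by simp
  qed
qed

lemma group_AutGroup: "group (AutGroup n)"
proof -
  have "subgroup (Aut n) (BijGroup (cube n))"
    using Fr_subgroup_aux[of "{}" n] by simp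
  then show ?thesis
    unfolding AutGroup_def by (rule subgroup.subgroup_is_group[OF _ group_BijGroup])
qed

lemma group_Fr:
  assumes "MR_subalgebra n A"
  shows "group (Fr n A)"
proof -
  have "A \<subseteq> cube n" using assms by (simp add: MR_subalgebra_def)
  from subgroup.subgroup_is_group[OF Fr_subgroup_aux[OF this] group_BijGroup]
  show ?thesis by (simp add: Fr_def AutGroup_def)
qed


subsection \<open>Existence of the type\<close>

lemma finite_cube: "finite (cube n)"
proof -
  have "cube n \<subseteq> Pow {1..n} \<times> Pow {1..n}" by (auto simp: cube_def)
  then show ?thesis by (rule finite_subset) simp
qed

lemma coatoms_cube:
  "coatoms (cube n) = (\<lambda>j. ({j}, {})) ` {1..n} \<union> (\<lambda>j. ({}, {j})) ` {1..n}" (is "_ = ?R")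
proof (intro subset_antisym subsetI)
  fix c assume c: "c \<in> coatoms (cube n)"
  then have cc: "c \<in> cube n" "c \<noteq> ctop" by (auto simp: coatoms_def)
  then consider j where "j \<in> fst c" | j where "j \<in> snd c"
    by (cases c) (auto simp: ctop_def)
  then show "c \<in> ?R"
  proof cases
    case (1 j)
    have "j \<in> {1..n}" "({j}, {}) \<in> cube n - {ctop}" "c \<preceq> ({j}, {})"
      using 1 cc by (auto simp: cube_simps)
    moreover from this have "({j}, {}) = c" using c by (auto simp: coatoms_def)
    ultimately show ?thesis by blast
  next
    case (2 j)
    have "j \<in> {1..n}" "({}, {j}) \<in> cube n - {ctop}" "c \<preceq> ({}, {j})"
      using 2 cc by (auto simp: cube_simps)
    moreover from this have "({}, {j}) = c" using c by (auto simp: coatoms_def)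
    ultimately show ?thesis by blast
  qed
qed (auto simp: coatoms_def cube_simps)

lemma card_coatoms_above:
  assumes "a \<in> cube n"
  shows "card (coatoms_above n a) = card (fst a) + card (snd a)"
proof -
  have sub: "fst a \<subseteq> {1..n}" "snd a \<subseteq> {1..n}" using assms by (auto simp: cube_def)
  then have fin: "finite (fst a)" "finite (snd a)"
    by (meson finite_atLeastAtMost finite_subset)+
  have "coatoms_above n a = (\<lambda>j. ({j}, {})) ` fst a \<union> (\<lambda>j. ({}, {j})) ` snd a"
    using sub unfolding coatoms_above_def coatoms_cube by (auto simp: cle_def image_iff)
  moreover have "card ((\<lambda>j. ({j}, {} :: nat set)) ` fst a) = card (fst a)"
    "card ((\<lambda>j. ({} :: nat set, {j})) ` snd a) = card (snd a)"
    by (auto intro!: card_image inj_onI)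
  ultimately show ?thesis
    using fin by (simp add: card_Un_disjoint disjoint_iff image_iff)
qed

lemma Delta_ctop: "Delta ctop a = (snd a, fst a)"
  by (simp add: cube_simps)

lemma Delta_ctop_coatoms:
  assumes A: "MR_subalgebra n A" and a: "a \<in> coatoms A"
  shows "Delta ctop a \<in> coatoms A"
proof -
  have cl: "Delta ctop b \<in> A" if "b \<in> A" for b
    using A that by (auto simp: MR_subalgebra_def cle_ctop)
  have inv: "Delta ctop (Delta ctop b) = b" for b by (simp add: Delta_ctop)
  have top: "Delta ctop b = ctop \<longleftrightarrow> b = ctop" for b
    by (cases b) (auto simp: Delta_def ctop_def)
  have ord: "Delta ctop b \<preceq> c \<longleftrightarrow> b \<preceq> Delta ctop c" for b c
    by (auto simp: Delta_ctop cle_def)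
  have "b = Delta ctop a" if "b \<in> A - {ctop}" "Delta ctop a \<preceq> b" for b
  proof -
    have "Delta ctop b \<in> A - {ctop}" "a \<preceq> Delta ctop b"
      using that cl top ord by auto
    then have "Delta ctop b = a" using a by (auto simp: coatoms_def)
    then show ?thesis using inv by metis
  qed
  then show ?thesis using a cl top by (auto simp: coatoms_def)
qed

lemma has_type_ex:
  assumes A: "MR_subalgebra n A"
  shows "\<exists>t. has_type n A t"
proof -
  have "even (card {a \<in> coatoms A. card (coatoms_above n a) = i})" for i
  proof -
    define S where "S = {a \<in> coatoms A. card (coatoms_above n a) = i}"
    define m where "m = (\<lambda>a :: signed_set. Min (fst a \<union> snd a))"
    define P where "P = {a \<in> S. m a \<in> fst a}"
    have SA: "S \<subseteq> cube n - {ctop}"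
      using A by (auto simp: S_def coatoms_def MR_subalgebra_def)
    have fin: "finite S" by (rule finite_subset[OF SA]) (simp add: finite_cube)
    have m: "m a \<in> fst a \<union> snd a" if "a \<in> S" for a
    proof -
      have "fst a \<union> snd a \<subseteq> {1..n}" "fst a \<union> snd a \<noteq> {}"
        using SA that by (cases a; auto simp: cube_simps)+
      then show ?thesis unfolding m_def by (meson Min_in finite_atLeastAtMost finite_subset)
    qed
    have disj: "fst a \<inter> snd a = {}" if "a \<in> S" for a
    proof -
      have "a \<in> cube n" using SA that by blast
      then show ?thesis by (auto simp: cube_def)
    qed
    have D: "Delta ctop a \<in> S" if "a \<in> S" for a
    proof -
      have "Delta ctop a \<in> cube n" "a \<in> cube n"
        using SA that by (auto intro!: Delta_in_cube ctop_in_cube simp: cle_ctop)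
      then show ?thesis
        using that Delta_ctop_coatoms[OF A]
        by (auto simp: S_def card_coatoms_above Delta_ctop)
    qed
    have mD: "m (Delta ctop a) = m a" for a by (simp add: m_def Delta_ctop Un_commute)
    have "S - P = Delta ctop ` P"
    proof (intro subset_antisym subsetI)
      fix a assume a: "a \<in> S - P"
      then have "m a \<in> snd a" using m[of a] by (auto simp: P_def)
      then have "Delta ctop a \<in> P" using a D mD by (auto simp: P_def Delta_ctop)
      moreover have "a = Delta ctop (Delta ctop a)" by (simp add: Delta_ctop)
      ultimately show "a \<in> Delta ctop ` P" by blast
    next
      fix a assume "a \<in> Delta ctop ` P"
      then obtain b where b: "b \<in> P" "a = Delta ctop b" by blast
      then have "m a \<notin> fst a"
        using disj[of b] mD[of b] by (auto simp: P_def Delta_ctop)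
      then show "a \<in> S - P" using b D by (auto simp: P_def)
    qed
    moreover have "inj_on (Delta ctop) P" by (auto simp: inj_on_def Delta_ctop prod_eq_iff)
    ultimately have "card (S - P) = card P" by (simp add: card_image)
    moreover have "card S = card P + card (S - P)"
    proof -
      have "P \<subseteq> S" by (auto simp: P_def)
      then show ?thesis using fin
        by (metis card_Diff_subset card_mono finite_subset le_add_diff_inverse)
    qed
    ultimately show ?thesis unfolding S_def by simp
  qed
  then have "has_type n A (\<lambda>i. card {a \<in> coatoms A. card (coatoms_above n a) = i} div 2)"
    by (simp add: has_type_def)
  then show ?thesis by blast
qed


subsection \<open>The difference \<open>n - r\<close> is not truncated\<close>

lemma coatom_fst_inj:
  assumes A: "MR_subalgebra n A" and a: "a \<in> coatoms A" "b \<in> coatoms A"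
    and j: "j \<in> fst a \<and> j \<in> fst b \<or> j \<in> snd a \<and> j \<in> snd b"
  shows "a = b"
proof -
  have "cjoin a b \<in> A - {ctop}" "a \<preceq> cjoin a b" "b \<preceq> cjoin a b"
    using A a j by (auto simp: MR_subalgebra_def coatoms_def cjoin_def ctop_def cle_def)
  then show ?thesis using a by (auto simp: coatoms_def)
qed

lemma sum_card_le:
  assumes "finite C" "\<And>a. a \<in> C \<Longrightarrow> f a \<subseteq> {1..n::nat}"
    and "\<And>a b j. a \<in> C \<Longrightarrow> b \<in> C \<Longrightarrow> j \<in> f a \<Longrightarrow> j \<in> f b \<Longrightarrow> a = b"
  shows "(\<Sum>a\<in>C. card (f a)) \<le> n"
proof -
  have "(\<Sum>a\<in>C. card (f a)) = card (\<Union>a\<in>C. f a)"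
  proof (rule card_UN_disjoint[symmetric])
    show "\<forall>i\<in>C. finite (f i)" using assms(2) by (meson finite_atLeastAtMost finite_subset)
  qed (use assms in blast)+
  also have "\<dots> \<le> card {1..n}" using assms(2) by (intro card_mono) auto
  finally show ?thesis by simp
qed

lemma type_sum_le:
  assumes A: "MR_subalgebra n A" and t: "has_type n A t"
  shows "(\<Sum>i=1..n. i * t i) \<le> n"
proof -
  let ?C = "coatoms A"
  have CA: "?C \<subseteq> cube n" using A by (auto simp: MR_subalgebra_def coatoms_def)
  have fin: "finite ?C" by (rule finite_subset[OF CA finite_cube])
  have "2 * (\<Sum>i=1..n. i * t i) = (\<Sum>i=1..n. i * (2 * t i))"
    by (simp add: sum_distrib_left mult_ac)
  also have "\<dots> = (\<Sum>i=1..n. i * card {a \<in> ?C. card (coatoms_above n a) = i})"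
    using t by (auto simp: has_type_def intro!: sum.cong)
  also have "\<dots> = (\<Sum>i=1..n. \<Sum>a\<in>{a \<in> ?C. card (coatoms_above n a) = i}.
      card (fst a) + card (snd a))"
  proof (rule sum.cong[OF refl])
    fix i
    have "(\<Sum>a | a \<in> ?C \<and> card (coatoms_above n a) = i. card (fst a) + card (snd a))
        = (\<Sum>a | a \<in> ?C \<and> card (coatoms_above n a) = i. i)"
      using CA card_coatoms_above by (intro sum.cong) auto
    then show "i * card {a \<in> ?C. card (coatoms_above n a) = i} =
        (\<Sum>a | a \<in> ?C \<and> card (coatoms_above n a) = i. card (fst a) + card (snd a))"
      by simp
  qed
  also have "\<dots> = (\<Sum>a\<in>(\<Union>i\<in>{1..n}. {a \<in> ?C. card (coatoms_above n a) = i}).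
      card (fst a) + card (snd a))"
    using fin by (subst sum.UNION_disjoint) auto
  also have "\<dots> \<le> (\<Sum>a\<in>?C. card (fst a) + card (snd a))"
    using fin by (intro sum_mono2) auto
  also have "\<dots> = (\<Sum>a\<in>?C. card (fst a)) + (\<Sum>a\<in>?C. card (snd a))"
    by (rule sum.distrib)
  also have "\<dots> \<le> n + n"
  proof (intro add_mono sum_card_le fin)
    show "fst a \<subseteq> {1..n}" "snd a \<subseteq> {1..n}" if "a \<in> ?C" for a
      using that CA by (force simp: cube_def)+
  qed (use coatom_fst_inj[OF A] in blast)+
  finally show ?thesis by simp
qed

end

theory Submission
  imports Defs "HOL-Combinatorics.Permutations"
begin

text \<open>Every automorphism of the cube is a signed permutation of the coordinates. In an MR-subalgebra
  \<open>A\<close> every element is the meet of the coatoms of \<open>A\<close> above it, because \<open>x \<le> a\<close> in \<open>A\<close> puts the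
  set difference of \<open>x\<close> and \<open>a\<close> into \<open>A\<close>; hence only the coatoms have to be fixed. Two coatoms
  that are neither equal nor antipodal have disjoint supports, of total size \<open>r\<close>. A signed
  permutation fixing all coatoms permutes each of these supports, and there its signs are forced,
  while it acts arbitrarily on the remaining \<open>n - r\<close> coordinates.\<close>

section \<open>Permutations preserving blocks\<close>

text \<open>Induction over the blocks: composition pairs each permutation of \<open>B\<close> with
  each block-preserving permutation of the remaining union, and every block-preserving permutation
  arises exactly once. An empty block is allowed and contributes the factor 1.\<close>

lemma card_permutes_blocks:
  assumes "finite C" "\<And>B. B \<in> C \<Longrightarrow> finite B" "pairwise disjnt C"
  shows "card {p. p permutes \<Union>C \<and> (\<forall>B\<in>C. p ` B = B)} = (\<Prod>B\<in>C. fact (card B))"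
  using assms
proof (induction C rule: finite_induct)
  case empty
  then show ?case by simp
next
  case (insert B C)
  define S where "S = (\<lambda>C :: 'a set set. {p. p permutes \<Union>C \<and> (\<forall>B\<in>C. p ` B = B)})"
  have dis: "B \<inter> B' = {}" if "B' \<in> C" for B'
    using insert.prems(2) insert.hyps(2) that by (auto simp: pairwise_insert disjnt_def)
  have IH: "card (S C) = (\<Prod>B\<in>C. fact (card B))"
    unfolding S_def using insert.prems by (intro insert.IH) (auto simp: pairwise_insert)
  have "bij_betw (\<lambda>(p, q). p \<circ> q) ({p. p permutes B} \<times> S C) (S (insert B C))"
    unfolding bij_betw_def
  proof (intro conjI subset_antisym subsetI)
    show "inj_on (\<lambda>(p, q). p \<circ> q) ({p. p permutes B} \<times> S C)"
    proof (rule inj_onI, clarify)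
      fix p q p' q'
      assume p: "p permutes B" "p' permutes B" and q: "q \<in> S C" "q' \<in> S C"
        and eq: "p \<circ> q = p' \<circ> q'"
      have eq': "p (q x) = p' (q' x)" for x using fun_cong[OF eq] by simp
      have "p x = p' x" for x
      proof (cases "x \<in> B")
        case True
        then have "x \<notin> \<Union>C" using dis by auto
        then have "q x = x" "q' x = x" using q by (auto simp: S_def permutes_not_in)
        then show ?thesis using eq'[of x] by simp
      qed (use p in \<open>simp add: permutes_not_in\<close>)
      then have "p = p'" by auto
      moreover from this have "q x = q' x" for x
        using eq'[of x] permutes_inj[OF p(1)] by (simp add: inj_eq)
      ultimately show "p = p' \<and> q = q'" by auto
    qed
  next
    fix s assume "s \<in> (\<lambda>(p, q). p \<circ> q) ` ({p. p permutes B} \<times> S C)"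
    then obtain p q where s: "s = p \<circ> q" and p: "p permutes B" and q: "q \<in> S C" by auto
    have "s permutes \<Union>(insert B C)"
      unfolding s using p q by (intro permutes_compose) (auto simp: S_def intro: permutes_subset)
    moreover have "s ` B = B"
    proof -
      have "q x = x" if "x \<in> B" for x
        using q dis that by (intro permutes_not_in[of q "\<Union>C"]) (auto simp: S_def)
      then have "q ` B = id ` B" by (intro image_cong) auto
      then show ?thesis using permutes_image[OF p] unfolding s image_comp[symmetric] by simp
    qed
    moreover have "s ` B' = B'" if "B' \<in> C" for B'
    proof -
      have "p x = x" if "x \<in> B'" for x
        using dis[OF \<open>B' \<in> C\<close>] that by (intro permutes_not_in[OF p]) auto
      then have "p ` B' = id ` B'" by (intro image_cong) auto
      then show ?thesis using q that unfolding s image_comp[symmetric] by (simp add: S_def)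
    qed
    ultimately show "s \<in> S (insert B C)" by (auto simp: S_def)
  next
    fix s assume "s \<in> S (insert B C)"
    then have s: "s permutes \<Union>(insert B C)" "\<And>B'. B' \<in> insert B C \<Longrightarrow> s ` B' = B'"
      unfolding S_def by blast+
    \<comment> \<open>\<open>s\<close> is split into its part on \<open>B\<close> and its part off
      \<open>B\<close>.\<close>
    define p where "p = (\<lambda>x. if x \<in> B then s x else x)"
    define q where "q = (\<lambda>x. if x \<in> B then x else s x)"
    have inj: "inj s" using s(1) by (rule permutes_inj)
    have "bij_betw s B B"
      using inj s(2) by (auto simp: bij_betw_def intro: inj_on_subset)
    then have "p permutes B"
      by (intro bij_imp_permutes) (auto simp: p_def cong: bij_betw_cong)
    moreover have "q ` B' = B'" if "B' \<in> C" for B'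
    proof -
      have "q ` B' = s ` B'" using dis[OF that] by (intro image_cong) (auto simp: q_def)
      then show ?thesis using s(2) that by simp
    qed
    moreover have "q permutes \<Union>C"
    proof (rule bij_imp_permutes)
      have "s ` \<Union>C = \<Union>C" using s(2) by (simp add: image_Union)
      then have "bij_betw s (\<Union>C) (\<Union>C)"
        using inj by (auto simp: bij_betw_def intro: inj_on_subset)
      moreover have "q x = s x" if "x \<in> \<Union>C" for x using that dis by (auto simp: q_def)
      ultimately show "bij_betw q (\<Union>C) (\<Union>C)" using bij_betw_cong[of "\<Union>C" q s] by blast
      show "q x = x" if "x \<notin> \<Union>C" for x
        using that s(1) by (auto simp: q_def permutes_not_in)
    qed
    moreover have "s = p \<circ> q"
    proof
      fix x
      have "s x \<in> B \<longleftrightarrow> x \<in> B" using inj s(2)[of B] by (metis inj_image_mem_iff insertI1)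
      then show "s x = (p \<circ> q) x" by (simp add: p_def q_def)
    qed
    ultimately show "s \<in> (\<lambda>(p, q). p \<circ> q) ` ({p. p permutes B} \<times> S C)"
      unfolding S_def by (intro image_eqI[of _ _ "(p, q)"]) auto
  qed
  then have "card (S (insert B C)) = card ({p. p permutes B} \<times> S C)"
    by (simp add: bij_betw_same_card)
  also have "\<dots> = fact (card B) * card (S C)"
    using insert.prems(1) by (simp add: card_cartesian_product card_permutations)
  finally show ?case using insert.hyps IH by (simp add: S_def)
qed


section \<open>Automorphisms of the cube are signed permutations\<close>

text \<open>The literals of the coordinates in \<open>E\<close> change sign.\<close>

definition signed_perm :: "(nat \<Rightarrow> nat) \<Rightarrow> nat set \<Rightarrow> signed_set \<Rightarrow> signed_set" where
  "signed_perm p E X = (p ` (fst X - E \<union> snd X \<inter> E), p ` (snd X - E \<union> fst X \<inter> E))"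

section \<open>Signed permutations act on the cube by automorphisms\<close>

lemma signed_perm_mem:
  assumes "inj p"
  shows "p j \<in> fst (signed_perm p E X) \<longleftrightarrow> (if j \<in> E then j \<in> snd X else j \<in> fst X)"
    and "p j \<in> snd (signed_perm p E X) \<longleftrightarrow> (if j \<in> E then j \<in> fst X else j \<in> snd X)"
  using assms by (auto simp: signed_perm_def inj_image_mem_iff)

lemma signed_perm_swap:
  "signed_perm p E (prod.swap X) = prod.swap (signed_perm p E X)"
  by (simp add: signed_perm_def)

lemma signed_perm_cle_iff:
  assumes "inj p"
  shows "signed_perm p E X \<preceq> signed_perm p E Y \<longleftrightarrow> X \<preceq> Y"
proof -
  have "signed_perm p E X \<preceq> signed_perm p E Y \<longleftrightarrow>
    fst Y - E \<union> snd Y \<inter> E \<subseteq> fst X - E \<union> snd X \<inter> E \<and>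
    snd Y - E \<union> fst Y \<inter> E \<subseteq> snd X - E \<union> fst X \<inter> E"
    using assms by (simp add: cle_def signed_perm_def inj_image_subset_iff)
  then show ?thesis unfolding cle_def by auto
qed

lemma signed_perm_Delta:
  assumes "inj p"
  shows "signed_perm p E (Delta x y) = Delta (signed_perm p E x) (signed_perm p E y)"
  unfolding signed_perm_def Delta_def fst_conv snd_conv prod.inject
    image_set_diff[OF assms, symmetric] image_Un[symmetric]
  by (intro conjI arg_cong[where f = "image p"]) auto

lemma signed_perm_in_cube:
  assumes p: "p permutes {1..n}" and X: "X \<in> cube n"
  shows "signed_perm p E X \<in> cube n"
proof -
  have *: "p ` D \<subseteq> {1..n}" if "D \<subseteq> {1..n}" for D
    using permutes_image[OF p] that by blast
  have "fst (signed_perm p E X) \<subseteq> {1..n}" "snd (signed_perm p E X) \<subseteq> {1..n}"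
    using X unfolding signed_perm_def fst_conv snd_conv by (intro *; fastforce simp: cube_def)+
  moreover have "fst (signed_perm p E X) \<inter> snd (signed_perm p E X) = {}"
    using X unfolding signed_perm_def
    by (simp add: image_Int[OF permutes_inj[OF p], symmetric]) (auto simp: cube_def)
  ultimately show ?thesis by (auto simp: cube_def split: prod.splits)
qed

text \<open>Injectivity comes from reflecting the antisymmetric order, surjectivity from the
  finiteness of the cube. The restriction provides the extensionality built into
  \<open>Bij\<close>.\<close>

lemma signed_perm_in_Aut:
  assumes p: "p permutes {1..n}"
  shows "restrict (signed_perm p E) (cube n) \<in> Aut n"
proof -
  have inj: "inj p" using p by (rule permutes_inj)
  have "inj_on (signed_perm p E) (cube n)"
    using signed_perm_cle_iff[OF inj] by (metis cle_antisym inj_onI subset_refl cle_def)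
  moreover have "signed_perm p E ` cube n = cube n"
    using endo_inj_surj[OF finite_cube _ calculation] signed_perm_in_cube[OF p] by blast
  ultimately have "restrict (signed_perm p E) (cube n) \<in> Bij (cube n)"
    by (simp add: Bij_def bij_betw_def)
  then show ?thesis
    by (simp add: Aut_def signed_perm_cle_iff[OF inj] signed_perm_Delta[OF inj] Delta_in_cube)
qed

text \<open>The image of the literal \<open>({j}, {})\<close> reveals both data: its coordinate is
  \<open>p j\<close>, and the component in which it sits tells whether \<open>j\<close> lies in
  \<open>E\<close>. Outside \<open>{1..n}\<close> both data are fixed by the assumptions.\<close>

lemma signed_perm_unique:
  assumes p: "p permutes {1..n}" "p' permutes {1..n}" and E: "E \<subseteq> {1..n}" "E' \<subseteq> {1..n}"
    and eq: "\<And>X. X \<in> cube n \<Longrightarrow> signed_perm p E X = signed_perm p' E' X"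
  shows "p = p'" "E = E'"
proof -
  have *: "p j = p' j \<and> (j \<in> E \<longleftrightarrow> j \<in> E')" for j
  proof (cases "j \<in> {1..n}")
    case True
    then have "signed_perm p E ({j}, {}) = signed_perm p' E' ({j}, {})"
      by (intro eq) (auto simp: cube_def)
    then show ?thesis by (cases "j \<in> E"; cases "j \<in> E'") (auto simp: signed_perm_def)
  next
    case False
    then show ?thesis using p E by (auto simp: permutes_not_in)
  qed
  then show "p = p'" "E = E'" by auto
qed

section \<open>Every automorphism is a signed permutation\<close>

lemma Aut_maps_coatoms:
  assumes f: "f \<in> Aut n" and c: "c \<in> coatoms (cube n)"
  shows "f c \<in> coatoms (cube n)"
proof -
  have bij: "bij_betw f (cube n) (cube n)" using f by (auto simp: Aut_def Bij_def)
  have ord: "f x \<preceq> f y \<longleftrightarrow> x \<preceq> y" if "x \<in> cube n" "y \<in> cube n" for x y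
    using f that by (auto simp: Aut_def)
  have mem: "f x \<in> cube n" if "x \<in> cube n" for x using bij that by (rule bij_betw_apply)
  have surj: "\<exists>x\<in>cube n. f x = y" if "y \<in> cube n" for y
    using bij that by (metis bij_betw_def imageE)
  have top: "f ctop = ctop"
    using surj[OF ctop_in_cube] ord cle_ctop cle_antisym mem by (metis ctop_in_cube)
  have c': "c \<in> cube n" "c \<noteq> ctop" using c by (auto simp: coatoms_def)
  have "f c \<noteq> ctop"
    using bij_betw_imp_inj_on[OF bij] c' top by (metis ctop_in_cube inj_onD)
  moreover have "b = f c" if b: "b \<in> cube n - {ctop}" "f c \<preceq> b" for b
  proof -
    obtain x where x: "x \<in> cube n" "f x = b" using surj b by blast
    then have "x \<noteq> ctop" "c \<preceq> x" using b top ord[OF c'(1) x(1)] by auto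
    then show ?thesis using c x by (auto simp: coatoms_def)
  qed
  ultimately show ?thesis using mem c' by (auto simp: coatoms_def)
qed

lemma cube_eqI_coatoms:
  assumes "x \<in> cube n" "y \<in> cube n"
    and "\<And>c. c \<in> coatoms (cube n) \<Longrightarrow> x \<preceq> c \<longleftrightarrow> y \<preceq> c"
  shows "x = y"
proof -
  have "j \<in> fst x \<longleftrightarrow> j \<in> fst y" "j \<in> snd x \<longleftrightarrow> j \<in> snd y" if "j \<in> {1..n}" for j
    using assms(3)[of "({j}, {})"] assms(3)[of "({}, {j})"] that
    by (auto simp: coatoms_cube cle_def)
  then show ?thesis using assms(1,2) by (cases x; cases y) (auto simp: cube_def)
qed

text \<open>Preserving the order makes \<open>f\<close> permute the literals, that is, the coatoms
  of the cube. Preserving \<open>Delta ctop\<close>, which swaps the two components, makes it send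
  opposite literals to opposite literals. Since an element is determined by the literals above it,
  \<open>f\<close> is the signed permutation read off from the images of the literals
  \<open>({j}, {})\<close>.\<close>

lemma Aut_signed_perm:
  assumes f: "f \<in> Aut n"
  obtains p E where "p permutes {1..n}" "E \<subseteq> {1..n}"
    "f = restrict (signed_perm p E) (cube n)"
proof -
  have bij: "bij_betw f (cube n) (cube n)" using f by (auto simp: Aut_def Bij_def)
  have inj: "inj_on f (cube n)" using bij by (rule bij_betw_imp_inj_on)
  have ord: "f x \<preceq> f y \<longleftrightarrow> x \<preceq> y" if "x \<in> cube n" "y \<in> cube n" for x y
    using f that by (auto simp: Aut_def)
  have mem: "f x \<in> cube n" if "x \<in> cube n" for x using bij that by (rule bij_betw_apply)
  have top: "f ctop = ctop"
    using bij ctop_in_cube[of n] ord cle_ctop cle_antisym mem by (metis bij_betw_iff_bijections)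
  have swap: "f (prod.swap x) = prod.swap (f x)" if "x \<in> cube n" for x
  proof -
    have "f (Delta ctop x) = Delta (f ctop) (f x)"
      using f that ctop_in_cube[of n] cle_ctop by (auto simp: Aut_def)
    then show ?thesis by (simp add: top Delta_ctop prod.swap_def)
  qed
  define E where "E = {j \<in> {1..n}. fst (f ({j}, {})) = {}}"
  have "\<exists>k\<in>{1..n}. f ({j}, {}) = (if j \<in> E then ({}, {k}) else ({k}, {}))"
    if "j \<in> {1..n}" for j
  proof -
    have "f ({j}, {}) \<in> coatoms (cube n)"
      using that by (intro Aut_maps_coatoms[OF f]) (auto simp: coatoms_cube)
    then show ?thesis using that by (auto simp: coatoms_cube E_def)
  qed
  then obtain k where k: "\<And>j. j \<in> {1..n} \<Longrightarrow> k j \<in> {1..n} \<and>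
      f ({j}, {}) = (if j \<in> E then ({}, {k j}) else ({k j}, {}))" by metis
  define p where "p = (\<lambda>j. if j \<in> {1..n} then k j else j)"
  have "inj_on p {1..n}"
  proof (rule inj_onI)
    fix i j assume ij: "i \<in> {1..n}" "j \<in> {1..n}" "p i = p j"
    have c: "({i}, {}) \<in> cube n" "({j}, {}) \<in> cube n" "({}, {j}) \<in> cube n"
      using ij by (auto simp: cube_def)
    \<comment> \<open>Two literals with the same coordinate are equal or opposite; injectivity of
      \<open>f\<close> rules out the opposite case and yields \<open>i = j\<close> in the
      other.\<close>
    have "f ({i}, {}) = f ({j}, {}) \<or> f ({i}, {}) = f ({}, {j})"
      using ij k[of i] k[of j] swap[OF c(2)] by (auto simp: p_def)
    then show "i = j" using inj c by (auto dest: inj_onD)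
  qed
  moreover from this have "p ` {1..n} = {1..n}"
    using k by (intro endo_inj_surj) (auto simp: p_def)
  ultimately have "bij_betw p {1..n} {1..n}" by (simp add: bij_betw_def)
  then have p: "p permutes {1..n}" by (rule bij_imp_permutes) (auto simp: p_def)
  have pos: "f ({j}, {}) = signed_perm p E ({j}, {})" if "j \<in> {1..n}" for j
    using k[OF that] that by (auto simp: signed_perm_def p_def)
  have agree: "f c = signed_perm p E c" if "c \<in> coatoms (cube n)" for c
    using that unfolding coatoms_cube
  proof (elim UnE imageE)
    fix j assume j: "j \<in> {1..n}" "c = ({}, {j})"
    then have "c = prod.swap ({j}, {})" "({j}, {}) \<in> cube n" by (auto simp: cube_def)
    then show ?thesis using swap pos[OF j(1)] by (simp only: signed_perm_swap)
  qed (simp add: pos)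
  have "f x = signed_perm p E x" if x: "x \<in> cube n" for x
  proof (rule cube_eqI_coatoms[OF mem[OF x] signed_perm_in_cube[OF p x]])
    fix d assume d: "d \<in> coatoms (cube n)"
    have "inj_on f (coatoms (cube n))" "finite (coatoms (cube n))"
      using inj finite_cube by (auto simp: coatoms_def intro: inj_on_subset)
    \<comment> \<open>Surjectivity on coatoms allows the test coatom \<open>d\<close> to be pulled
      back to some \<open>c\<close>, where \<open>f\<close> and the signed permutation already
      agree.\<close>
    then have "f ` coatoms (cube n) = coatoms (cube n)"
      using Aut_maps_coatoms[OF f] by (intro endo_inj_surj) auto
    then obtain c where c: "c \<in> coatoms (cube n)" "d = f c" using d by blast
    have "c \<in> cube n" using c by (auto simp: coatoms_def)
    then show "f x \<preceq> d \<longleftrightarrow> signed_perm p E x \<preceq> d"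
      using ord[OF x] agree[OF c(1)] signed_perm_cle_iff[OF permutes_inj[OF p]] c(2) by metis
  qed
  moreover have "f \<in> extensional (cube n)" using f by (auto simp: Aut_def Bij_def)
  ultimately have "f = restrict (signed_perm p E) (cube n)"
    by (auto simp: extensional_def restrict_def)
  moreover have "E \<subseteq> {1..n}" by (auto simp: E_def)
  ultimately show ?thesis using that p by blast
qed

text \<open>Turns the group order into a count of pairs. Requiring \<open>E\<close> to lie in
  \<open>{1..n}\<close> makes the pair representing an automorphism unique.\<close>

lemma order_Fr_eq_card_signed_perms:
  assumes "A \<subseteq> cube n"
  shows "order (Fr n A) = card {(p, E). p permutes {1..n} \<and> E \<subseteq> {1..n} \<and>
    (\<forall>x\<in>A. signed_perm p E x = x)}" (is "_ = card ?K")
proof -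
  have "bij_betw (\<lambda>(p, E). restrict (signed_perm p E) (cube n)) ?K
    {f \<in> Aut n. \<forall>x\<in>A. f x = x}"
    unfolding bij_betw_def
  proof (intro conjI subset_antisym subsetI)
    show "inj_on (\<lambda>(p, E). restrict (signed_perm p E) (cube n)) ?K"
    proof (rule inj_onI, clarify)
      fix p E p' E'
      assume *: "p permutes {1..n}" "p' permutes {1..n}" "E \<subseteq> {1..n}" "E' \<subseteq> {1..n}"
        and eq: "restrict (signed_perm p E) (cube n) = restrict (signed_perm p' E') (cube n)"
      have "signed_perm p E X = signed_perm p' E' X" if "X \<in> cube n" for X
        using fun_cong[OF eq, of X] that by simp
      then show "p = p' \<and> E = E'" using signed_perm_unique[OF *] by blast
    qed
  next
    fix f assume "f \<in> (\<lambda>(p, E). restrict (signed_perm p E) (cube n)) ` ?K"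
    then show "f \<in> {f \<in> Aut n. \<forall>x\<in>A. f x = x}"
      using signed_perm_in_Aut assms by auto
  next
    fix f assume f: "f \<in> {f \<in> Aut n. \<forall>x\<in>A. f x = x}"
    then obtain p E where pE: "p permutes {1..n}" "E \<subseteq> {1..n}"
      "f = restrict (signed_perm p E) (cube n)" using Aut_signed_perm by blast
    have "\<forall>x\<in>A. signed_perm p E x = x"
    proof
      fix x assume "x \<in> A"
      then have "f x = x" "x \<in> cube n" using f assms by auto
      then show "signed_perm p E x = x" using pE(3) by simp
    qed
    then show "f \<in> (\<lambda>(p, E). restrict (signed_perm p E) (cube n)) ` ?K"
      using pE by (intro image_eqI[of _ _ "(p, E)"]) auto
  qed
  then show ?thesis by (simp add: order_def Fr_def bij_betw_same_card)
qed


section \<open>Coatoms of an MR-subalgebra\<close>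

definition supp :: "signed_set \<Rightarrow> nat set" where
  "supp x = fst x \<union> snd x"

lemma supp_swap: "supp (prod.swap x) = supp x"
  by (auto simp: supp_def)

lemma supp_subset: "x \<in> cube n \<Longrightarrow> supp x \<subseteq> {1..n}"
  by (auto simp: supp_def cube_def)

lemma finite_supp: "x \<in> cube n \<Longrightarrow> finite (supp x)"
  using supp_subset finite_subset by blast

lemma card_coatoms_above_eq_card_supp:
  assumes x: "x \<in> cube n"
  shows "card (coatoms_above n x) = card (supp x)"
proof -
  have "fst x \<inter> snd x = {}" using x by (auto simp: cube_def)
  then show ?thesis using finite_supp[OF x]
    by (simp add: card_coatoms_above[OF x] supp_def card_Un_disjoint)
qed

lemma swap_in_coatoms:
  "MR_subalgebra n A \<Longrightarrow> a \<in> coatoms A \<Longrightarrow> prod.swap a \<in> coatoms A"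
  using Delta_ctop_coatoms by (simp add: Delta_ctop prod.swap_def)

text \<open>\<open>Delta a x\<close> keeps the literals of \<open>a\<close> and negates the other
  literals of \<open>x\<close>. Its antipode therefore restores the latter and negates those of
  \<open>a\<close>, so its join with \<open>x\<close> retains exactly the literals of
  \<open>x\<close> outside \<open>a\<close>.\<close>

lemma MR_subalgebra_diff:
  assumes A: "MR_subalgebra n A" and x: "x \<in> A" "a \<in> A" "x \<preceq> a"
  shows "(fst x - fst a, snd x - snd a) \<in> A"
proof -
  have "cjoin x (Delta ctop (Delta a x)) \<in> A"
    using A x cle_ctop unfolding MR_subalgebra_def by blast
  moreover have "cjoin x (Delta ctop (Delta a x)) = (fst x - fst a, snd x - snd a)"
  proof -
    have "x \<in> cube n" using A x(1) by (auto simp: MR_subalgebra_def)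
    then have "fst x \<inter> snd x = {}" by (auto simp: cube_def)
    then show ?thesis using x(3) by (auto simp: cjoin_def Delta_def ctop_def cle_def)
  qed
  ultimately show ?thesis by simp
qed

text \<open>Among the elements of \<open>A\<close> between \<open>x\<close> and \<open>l\<close>,
  one of least support is a coatom: a nontrivial element of \<open>A\<close> strictly above it would
  split it into two smaller elements of \<open>A\<close>, one of which still lies below
  \<open>l\<close>.\<close>

lemma coatom_above_literal:
  assumes A: "MR_subalgebra n A" and x: "x \<in> A" and l: "l \<in> coatoms (cube n)" "x \<preceq> l"
  obtains a where "a \<in> coatoms A" "x \<preceq> a" "a \<preceq> l"
proof -
  define Y where "Y = {y \<in> A. x \<preceq> y \<and> y \<preceq> l}"
  have "x \<in> Y" using x l by (auto simp: Y_def cle_def)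
  then obtain y where y: "y \<in> Y" "\<And>z. z \<in> Y \<Longrightarrow> card (supp y) \<le> card (supp z)"
    using ex_has_least_nat[of "\<lambda>y. y \<in> Y" x "\<lambda>y. card (supp y)"] by blast
  have sub: "A \<subseteq> cube n" using A by (simp add: MR_subalgebra_def)
  then have yc: "y \<in> A" "y \<in> cube n" using y by (auto simp: Y_def)
  have less: "False" if z: "z \<in> Y" "y \<preceq> z" "supp z \<noteq> supp y" for z
  proof -
    have "supp z \<subset> supp y" using z by (auto simp: cle_def supp_def)
    then show False
      using y(2)[OF z(1)] psubset_card_mono[OF finite_supp[OF yc(2)], of "supp z"] by simp
  qed
  have "b = y" if b: "b \<in> A - {ctop}" "y \<preceq> b" for b
  proof (rule ccontr)
    assume "b \<noteq> y"
    have bc: "b \<in> cube n" using b sub by auto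
    define d where "d = (fst y - fst b, snd y - snd b)"
    have dA: "d \<in> A" unfolding d_def using b by (intro MR_subalgebra_diff[OF A yc(1)]) auto
    \<comment> \<open>\<open>l\<close> is a single literal of \<open>y\<close>, so it belongs either
      to \<open>b\<close> or to the difference \<open>d\<close>; both have smaller support than
      \<open>y\<close>.\<close>
    have "b \<preceq> l \<or> d \<preceq> l"
      using l(1) y(1) unfolding coatoms_cube by (auto simp: Y_def d_def cle_def)
    then show False
    proof
      assume "b \<preceq> l"
      then have "b \<in> Y" using b y(1) by (auto simp: Y_def cle_def)
      moreover have "supp b \<noteq> supp y"
      proof
        assume "supp b = supp y"
        then have "y = b" using b(2) yc(2) bc
          by (cases y; cases b) (auto simp: supp_def cle_def cube_def)
        then show False using \<open>b \<noteq> y\<close> by simp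
      qed
      ultimately show False using less b by blast
    next
      assume "d \<preceq> l"
      then have "d \<in> Y" using dA y(1) by (auto simp: Y_def cle_def d_def)
      moreover have "supp d \<noteq> supp y"
      proof -
        obtain j where "j \<in> supp b" using b(1) by (cases b) (auto simp: supp_def ctop_def)
        moreover have "fst y \<inter> snd y = {}" using yc(2) by (auto simp: cube_def)
        ultimately have "j \<in> supp y" "j \<notin> supp d"
          using b(2) by (auto simp: supp_def cle_def d_def)
        then show ?thesis by blast
      qed
      ultimately show False using less[of d] by (auto simp: d_def cle_def)
    qed
  qed
  moreover have "y \<noteq> ctop" using y(1) l(1) by (auto simp: Y_def cle_def ctop_def coatoms_cube)
  ultimately have "y \<in> coatoms A" using yc by (auto simp: coatoms_def)
  then show ?thesis using that y(1) by (auto simp: Y_def)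
qed

text \<open>At a shared coordinate the signs agree or differ. If they agree, the join of the two
  coatoms is not the top, which forces equality; if they differ, the same argument applies to
  \<open>a\<close> and the antipode of \<open>b\<close>.\<close>

lemma coatoms_supp_meet:
  assumes A: "MR_subalgebra n A" and a: "a \<in> coatoms A" "b \<in> coatoms A"
    and j: "j \<in> supp a" "j \<in> supp b"
  shows "a = b \<or> a = prod.swap b"
  using coatom_fst_inj[OF A a, of j] j
    coatom_fst_inj[OF A a(1) swap_in_coatoms[OF A a(2)], of j]
  by (auto simp: supp_def)

text \<open>Each literal of \<open>x\<close> belongs to a coatom \<open>a\<close> of
  \<open>A\<close> above \<open>x\<close>. The image of \<open>x\<close> is still below the fixed
  element \<open>a\<close>, so it contains all literals of \<open>x\<close>; a comparison of sizes
  then gives equality.\<close>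

lemma signed_perm_fixes_iff_coatoms:
  assumes A: "MR_subalgebra n A" and p: "p permutes {1..n}"
  shows "(\<forall>x\<in>A. signed_perm p E x = x) \<longleftrightarrow> (\<forall>a\<in>coatoms A. signed_perm p E a = a)"
proof (intro iffI ballI)
  fix x assume fix_co: "\<forall>a\<in>coatoms A. signed_perm p E a = a" and x: "x \<in> A"
  have inj: "inj p" using p by (rule permutes_inj)
  have sub: "A \<subseteq> cube n" using A by (simp add: MR_subalgebra_def)
  have le: "signed_perm p E x \<preceq> x"
  proof -
    have "signed_perm p E x \<preceq> l" if l: "l \<in> coatoms (cube n)" "x \<preceq> l" for l
    proof -
      obtain a where a: "a \<in> coatoms A" "x \<preceq> a" "a \<preceq> l"
        using coatom_above_literal[OF A x l] .
      then have "signed_perm p E x \<preceq> a"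
        using fix_co signed_perm_cle_iff[OF inj, of E x a] by simp
      then show ?thesis using a by (auto simp: cle_def)
    qed
    note * = this
    have j: "j \<in> {1..n}" if "j \<in> fst x \<or> j \<in> snd x" for j
      using that subsetD[OF sub x] by (auto simp: cube_def)
    have "j \<in> fst (signed_perm p E x)" if "j \<in> fst x" for j
      using *[of "({j}, {})"] that j[of j] by (simp add: coatoms_cube cle_def)
    moreover have "j \<in> snd (signed_perm p E x)" if "j \<in> snd x" for j
      using *[of "({}, {j})"] that j[of j] by (simp add: coatoms_cube cle_def)
    ultimately show ?thesis by (auto simp: cle_def)
  qed
  \<comment> \<open>The support is only moved by the injection \<open>p\<close>, so its size is kept
    and the inclusion given by \<open>le\<close> becomes an equality of supports.\<close>
  have "supp (signed_perm p E x) = p ` supp x" by (auto simp: signed_perm_def supp_def)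
  then have "card (supp (signed_perm p E x)) = card (supp x)"
    using inj by (simp add: card_image inj_on_subset)
  moreover have xc: "x \<in> cube n" "signed_perm p E x \<in> cube n"
    using subsetD[OF sub x] signed_perm_in_cube[OF p] by simp_all
  moreover have "supp x \<subseteq> supp (signed_perm p E x)" using le by (auto simp: supp_def cle_def)
  ultimately have "supp x = supp (signed_perm p E x)"
    using finite_supp by (metis card_subset_eq)
  then show "signed_perm p E x = x" using le xc
    by (cases x; cases "signed_perm p E x") (auto simp: supp_def cle_def cube_def)
qed (auto simp: coatoms_def)

text \<open>On the support of \<open>a\<close> the sign is a single bit, membership in
  \<open>fst a\<close>. Fixing \<open>a\<close> means that \<open>p\<close> permutes the support and
  that \<open>E\<close> flips exactly the coordinates whose bit differs from that of their
  image.\<close>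

lemma signed_perm_fixes_iff:
  assumes p: "p permutes {1..n}" and a: "a \<in> cube n"
  shows "signed_perm p E a = a \<longleftrightarrow> p ` supp a = supp a \<and>
    (\<forall>j\<in>supp a. j \<in> E \<longleftrightarrow> (j \<in> fst a) \<noteq> (p j \<in> fst a))" (is "?L \<longleftrightarrow> ?R")
proof
  have inj: "inj p" using p by (rule permutes_inj)
  have dis: "fst a \<inter> snd a = {}" using a by (auto simp: cube_def)
  {
    assume L: ?L
    have "p ` supp a = supp (signed_perm p E a)" by (auto simp: signed_perm_def supp_def)
    then have *: "p ` supp a = supp a" using L by simp
    have "j \<in> E \<longleftrightarrow> (j \<in> fst a) \<noteq> (p j \<in> fst a)" if "j \<in> supp a" for j
      using signed_perm_mem(1)[OF inj, of j E a] L that dis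
      by (auto simp: supp_def split: if_splits)
    with * show ?R by blast
  next
    assume R: ?R
    have inv: "j \<in> supp a" if "p j \<in> supp a" for j
      using R that inj by (metis inj_image_mem_iff)
    have f: "p j \<in> fst (signed_perm p E a) \<longleftrightarrow> p j \<in> fst a"
      and s: "p j \<in> snd (signed_perm p E a) \<longleftrightarrow> p j \<in> snd a" for j
    proof -
      have "p j \<in> supp a" "j \<in> E \<longleftrightarrow> (j \<in> fst a) \<noteq> (p j \<in> fst a)" if "j \<in> supp a"
        using R that by auto
      then show "p j \<in> fst (signed_perm p E a) \<longleftrightarrow> p j \<in> fst a"
        "p j \<in> snd (signed_perm p E a) \<longleftrightarrow> p j \<in> snd a"
        using inv[of j] dis by (auto simp: signed_perm_mem[OF inj] supp_def)
    qed
    have "k \<in> fst (signed_perm p E a) \<longleftrightarrow> k \<in> fst a"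
      "k \<in> snd (signed_perm p E a) \<longleftrightarrow> k \<in> snd a" for k
      using f[of "inv_into UNIV p k"] s[of "inv_into UNIV p k"] permutes_inverses(1)[OF p] by auto
    then show ?L by (auto simp: prod_eq_iff)
  }
qed


section \<open>The order of the fixing group\<close>

text \<open>One coatom from each antipodal pair.\<close>

definition positive_coatoms :: "signed_set set \<Rightarrow> signed_set set" where
  "positive_coatoms A = {a \<in> coatoms A. Min (supp a) \<in> fst a}"

context
  fixes n :: nat and A :: "signed_set set"
  assumes A: "MR_subalgebra n A"
begin

lemma coatoms_in_cube: "a \<in> coatoms A \<Longrightarrow> a \<in> cube n"
  using A by (auto simp: MR_subalgebra_def coatoms_def)

lemma finite_positive_coatoms: "finite (positive_coatoms A)"
  by (rule finite_subset[OF _ finite_cube[of n]])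
    (auto simp: positive_coatoms_def coatoms_in_cube)

lemma supp_coatom_nonempty: "a \<in> coatoms A \<Longrightarrow> supp a \<noteq> {}"
  by (cases a) (auto simp: coatoms_def supp_def ctop_def)

text \<open>The least coordinate of the support lies in exactly one component, and the swap
  exchanges the components while keeping the support.\<close>

lemma swap_positive_coatoms_iff:
  assumes a: "a \<in> coatoms A"
  shows "prod.swap a \<in> positive_coatoms A \<longleftrightarrow> a \<notin> positive_coatoms A"
proof -
  have "Min (supp a) \<in> supp a"
    using finite_supp[OF coatoms_in_cube[OF a]] supp_coatom_nonempty[OF a] by (rule Min_in)
  moreover have "fst a \<inter> snd a = {}" using coatoms_in_cube[OF a] by (auto simp: cube_def)
  ultimately show ?thesis using a swap_in_coatoms[OF A a]
    by (auto simp: positive_coatoms_def supp_swap) (auto simp: supp_def)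
qed

lemma positive_coatoms_disjoint:
  assumes "a \<in> positive_coatoms A" "b \<in> positive_coatoms A" "j \<in> supp a" "j \<in> supp b"
  shows "a = b"
  using assms coatoms_supp_meet[OF A, of a b j] swap_positive_coatoms_iff[of b]
  by (auto simp: positive_coatoms_def)

text \<open>The coatoms with support of size \<open>i\<close> are the disjoint union of the positive
  ones and their antipodes, which halves the count \<open>2 * t i\<close>.\<close>

lemma card_positive_coatoms:
  assumes t: "has_type n A t" and i: "i \<in> {1..n}"
  shows "card {a \<in> positive_coatoms A. card (supp a) = i} = t i"
proof -
  let ?P = "{a \<in> positive_coatoms A. card (supp a) = i}"
  have "{a \<in> coatoms A. card (coatoms_above n a) = i} = ?P \<union> prod.swap ` ?P"
  proof (intro subset_antisym subsetI)
    fix a assume "a \<in> {a \<in> coatoms A. card (coatoms_above n a) = i}"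
    then have a: "a \<in> coatoms A" "card (supp a) = i"
      using card_coatoms_above_eq_card_supp[OF coatoms_in_cube, of a] by simp_all
    then have "a \<in> ?P \<or> prod.swap a \<in> ?P"
      using swap_positive_coatoms_iff by (auto simp: supp_swap)
    then show "a \<in> ?P \<union> prod.swap ` ?P"
      using image_eqI[of a prod.swap "prod.swap a" ?P] by auto
  next
    fix a assume "a \<in> ?P \<union> prod.swap ` ?P"
    then have "a \<in> coatoms A" "card (supp a) = i"
      using swap_in_coatoms[OF A] supp_swap by (auto simp: positive_coatoms_def simp del: swap_simp)
    then show "a \<in> {a \<in> coatoms A. card (coatoms_above n a) = i}"
      using card_coatoms_above_eq_card_supp[OF coatoms_in_cube, of a] by simp
  qed
  moreover have "prod.swap a \<notin> ?P" if "a \<in> ?P" for a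
  proof -
    have "a \<in> positive_coatoms A" "a \<in> coatoms A" using that by (simp_all add: positive_coatoms_def)
    then show ?thesis using swap_positive_coatoms_iff[of a] by simp
  qed
  then have "?P \<inter> prod.swap ` ?P = {}" by blast
  ultimately have "card {a \<in> coatoms A. card (coatoms_above n a) = i} = 2 * card ?P"
    using finite_positive_coatoms by (simp add: card_Un_disjoint card_image inj_on_subset[OF inj_swap])
  moreover have "2 * t i = card {a \<in> coatoms A. card (coatoms_above n a) = i}"
    using t i unfolding has_type_def by blast
  ultimately show ?thesis by simp
qed

section \<open>Grouping the blocks by size\<close>

lemma card_supp_positive_coatoms: "(\<lambda>a. card (supp a)) ` positive_coatoms A \<subseteq> {1..n}"
proof clarify
  fix a assume "a \<in> positive_coatoms A"
  then have a: "a \<in> coatoms A" by (simp add: positive_coatoms_def)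
  have "card (supp a) \<le> card {1..n}"
    using supp_subset[OF coatoms_in_cube[OF a]] by (intro card_mono) auto
  moreover have "card (supp a) > 0"
    using finite_supp[OF coatoms_in_cube[OF a]] supp_coatom_nonempty[OF a] by (simp add: card_gt_0_iff)
  ultimately show "card (supp a) \<in> {1..n}" by simp
qed

text \<open>The supports of the positive coatoms are disjoint, so their sizes add up. This
  identifies \<open>r\<close> as the number of coordinates used by the coatoms.\<close>

lemma card_Union_supp:
  assumes t: "has_type n A t"
  shows "card (\<Union>(supp ` positive_coatoms A)) = (\<Sum>i=1..n. i * t i)"
proof -
  have "card (\<Union>(supp ` positive_coatoms A)) = (\<Sum>a\<in>positive_coatoms A. card (supp a))"
  proof (rule card_UN_disjoint[OF finite_positive_coatoms])
    show "\<forall>a\<in>positive_coatoms A. finite (supp a)"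
      using finite_supp[OF coatoms_in_cube] by (auto simp: positive_coatoms_def)
  qed (use positive_coatoms_disjoint in blast)
  also have "\<dots> = (\<Sum>i=1..n. \<Sum>a\<in>{a \<in> positive_coatoms A. card (supp a) = i}. card (supp a))"
    using finite_positive_coatoms card_supp_positive_coatoms by (intro sum.group[symmetric]) auto
  also have "\<dots> = (\<Sum>i=1..n. i * t i)"
    by (intro sum.cong) (auto simp: card_positive_coatoms[OF t, symmetric])
  finally show ?thesis .
qed

lemma prod_fact_positive_coatoms:
  assumes t: "has_type n A t"
  shows "(\<Prod>a\<in>positive_coatoms A. fact (card (supp a)) :: nat) = (\<Prod>i=1..n. fact i ^ t i)"
proof -
  have "(\<Prod>a\<in>positive_coatoms A. fact (card (supp a)) :: nat) =
    (\<Prod>i=1..n. \<Prod>a\<in>{a \<in> positive_coatoms A. card (supp a) = i}. fact (card (supp a)))"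
    using finite_positive_coatoms card_supp_positive_coatoms by (intro prod.group[symmetric]) auto
  also have "\<dots> = (\<Prod>i=1..n. fact i ^ t i)"
    by (intro prod.cong) (auto simp: card_positive_coatoms[OF t, symmetric])
  finally show ?thesis .
qed

lemma card_block_permutations:
  assumes t: "has_type n A t" and r: "r = (\<Sum>i=1..n. i * t i)"
  shows "card {p. p permutes {1..n} \<and> (\<forall>a\<in>positive_coatoms A. p ` supp a = supp a)} =
    fact (n - r) * (\<Prod>i=1..n. fact i ^ t i)"
proof -
  let ?P = "positive_coatoms A"
  define R where "R = \<Union>(supp ` ?P)"
  define U where "U = {1..n} - R"
  have R: "R \<subseteq> {1..n}"
    using supp_subset coatoms_in_cube by (force simp: R_def positive_coatoms_def)
  have Un: "\<Union>(insert U (supp ` ?P)) = {1..n}" using R by (auto simp: U_def R_def)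
  have "p ` U = U" if p: "p permutes {1..n}" "\<forall>a\<in>?P. p ` supp a = supp a" for p
  proof -
    have "p ` R = R" using p(2) by (simp add: R_def image_UN)
    then show ?thesis
      using permutes_image[OF p(1)] by (simp add: U_def image_set_diff[OF permutes_inj[OF p(1)]])
  qed
  then have "{p. p permutes {1..n} \<and> (\<forall>a\<in>?P. p ` supp a = supp a)} =
    {p. p permutes \<Union>(insert U (supp ` ?P)) \<and> (\<forall>B\<in>insert U (supp ` ?P). p ` B = B)}"
    unfolding Un by auto
  also have "card \<dots> = (\<Prod>B\<in>insert U (supp ` ?P). fact (card B))"
  proof (rule card_permutes_blocks)
    show "finite B" if "B \<in> insert U (supp ` ?P)" for B
      using that Un by (metis Union_upper finite_atLeastAtMost finite_subset)
    show "pairwise disjnt (insert U (supp ` ?P))"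
      unfolding pairwise_insert using positive_coatoms_disjoint
      by (auto simp: disjnt_def U_def R_def intro!: pairwise_imageI dest: positive_coatoms_disjoint)
  qed (simp add: finite_positive_coatoms)
  also have "\<dots> = fact (card U) * (\<Prod>B\<in>supp ` ?P. fact (card B))"
  proof (rule prod.insert)
    \<comment> \<open>\<open>U\<close> is disjoint from all supports, and supports are nonempty, so
      \<open>U\<close> is a new block even when it is empty.\<close>
    show "U \<notin> supp ` ?P"
    proof
      assume "U \<in> supp ` ?P"
      then obtain a where a: "a \<in> ?P" "U = supp a" by blast
      then have "U \<subseteq> R" by (auto simp: R_def)
      then have "supp a = {}" using a by (auto simp: U_def)
      then show False using supp_coatom_nonempty[of a] a by (simp add: positive_coatoms_def)
    qed
  qed (simp add: finite_positive_coatoms)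
  also have "(\<Prod>B\<in>supp ` ?P. fact (card B)) = (\<Prod>a\<in>?P. fact (card (supp a)))"
  proof (rule prod.reindex_cong[OF _ refl refl])
    show "inj_on supp ?P"
    proof (rule inj_onI)
      fix a b assume ab: "a \<in> ?P" "b \<in> ?P" "supp a = supp b"
      then have "supp a \<noteq> {}" using supp_coatom_nonempty[of a] by (simp add: positive_coatoms_def)
      then obtain j where "j \<in> supp a" by blast
      then show "a = b" using positive_coatoms_disjoint ab by blast
    qed
  qed
  also have "card U = n - r"
    using R card_Union_supp[OF t] r
    by (simp add: U_def card_Diff_subset finite_subset R_def[symmetric])
  finally show ?thesis by (simp add: prod_fact_positive_coatoms[OF t])
qed

lemma card_fixing_signed_perms:
  assumes t: "has_type n A t" and r: "r = (\<Sum>i=1..n. i * t i)"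
  shows "card {(p, E). p permutes {1..n} \<and> E \<subseteq> {1..n} \<and> (\<forall>x\<in>A. signed_perm p E x = x)} =
    2 ^ (n - r) * fact (n - r) * (\<Prod>i=1..n. fact i ^ t i)" (is "card ?K = _")
proof -
  let ?P = "positive_coatoms A"
  define R where "R = \<Union>(supp ` ?P)"
  define U where "U = {1..n} - R"
  \<comment> \<open>On the support of each positive coatom \<open>G\<close> agrees with its first
    component, so one set records the signs of all blocks at once.\<close>
  define G where "G = \<Union>(fst ` ?P)"
  \<comment> \<open>the sign changes that a permutation forces on the coordinates of the blocks\<close>
  define flips where "flips = (\<lambda>p. {j \<in> R. (j \<in> G) \<noteq> (p j \<in> G)})"
  define Q where "Q = {p. p permutes {1..n} \<and> (\<forall>a\<in>?P. p ` supp a = supp a)}"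
  have R: "R \<subseteq> {1..n}"
    using supp_subset coatoms_in_cube by (force simp: R_def positive_coatoms_def)
  have P: "a \<in> coatoms A" if "a \<in> ?P" for a using that by (simp add: positive_coatoms_def)
  have G: "j \<in> G \<longleftrightarrow> j \<in> fst a" if "a \<in> ?P" "j \<in> supp a" for a j
  proof
    assume "j \<in> G"
    then obtain b where b: "b \<in> ?P" "j \<in> fst b" by (auto simp: G_def)
    then have "a = b" using positive_coatoms_disjoint[OF that(1) b(1) that(2)] by (simp add: supp_def)
    then show "j \<in> fst a" using b by simp
  qed (use that in \<open>auto simp: G_def\<close>)
  have fixes_iff: "(\<forall>x\<in>A. signed_perm p E x = x) \<longleftrightarrow> p \<in> Q \<and> E \<inter> R = flips p"
    if p: "p permutes {1..n}" for p E
  proof -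
    have "(\<forall>x\<in>A. signed_perm p E x = x) \<longleftrightarrow> (\<forall>a\<in>?P. signed_perm p E a = a)"
      unfolding signed_perm_fixes_iff_coatoms[OF A p]
    proof (intro iffI ballI)
      fix a assume h: "\<forall>a\<in>?P. signed_perm p E a = a" and a: "a \<in> coatoms A"
      \<comment> \<open>Signed permutations commute with the swap, so fixing one coatom of an
        antipodal pair fixes the other.\<close>
      then have "a \<in> ?P \<or> prod.swap a \<in> ?P" using swap_positive_coatoms_iff by blast
      then show "signed_perm p E a = a"
        using h by (metis signed_perm_swap swap_swap)
    qed (use P in blast)
    also have "\<dots> \<longleftrightarrow> (\<forall>a\<in>?P. p ` supp a = supp a \<and>
        (\<forall>j\<in>supp a. j \<in> E \<longleftrightarrow> (j \<in> G) \<noteq> (p j \<in> G)))"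
    proof (rule ball_cong[OF refl])
      fix a assume a: "a \<in> ?P"
      have *: "(j \<in> G) = (j \<in> fst a) \<and> (p j \<in> G) = (p j \<in> fst a)"
        if "p ` supp a = supp a" "j \<in> supp a" for j
        using G[OF a] that by blast
      show "signed_perm p E a = a \<longleftrightarrow> p ` supp a = supp a \<and>
        (\<forall>j\<in>supp a. j \<in> E \<longleftrightarrow> (j \<in> G) \<noteq> (p j \<in> G))"
        unfolding signed_perm_fixes_iff[OF p coatoms_in_cube[OF P[OF a]]]
        by (intro conj_cong refl ball_cong) (simp_all add: *)
    qed
    also have "\<dots> \<longleftrightarrow> p \<in> Q \<and> (\<forall>j\<in>R. j \<in> E \<longleftrightarrow> (j \<in> G) \<noteq> (p j \<in> G))"
      using p by (auto simp: Q_def R_def)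
    also have "(\<forall>j\<in>R. j \<in> E \<longleftrightarrow> (j \<in> G) \<noteq> (p j \<in> G)) \<longleftrightarrow> E \<inter> R = flips p"
      by (auto simp: flips_def)
    finally show ?thesis .
  qed
  have "bij_betw (\<lambda>(p, E). (p, E \<union> flips p)) (Q \<times> Pow U) ?K"
  \<comment> \<open>The inverse map forgets the forced sign changes and keeps the free part of
    \<open>E\<close> in \<open>U\<close>.\<close>
  proof (rule bij_betw_byWitness[where f' = "\<lambda>(p, E). (p, E \<inter> U)"])
    show "\<forall>x\<in>Q \<times> Pow U. (case case x of (p, E) \<Rightarrow> (p, E \<union> flips p) of (p, E) \<Rightarrow> (p, E \<inter> U)) = x"
      by (auto simp: U_def flips_def)
    show "\<forall>x\<in>?K. (case case x of (p, E) \<Rightarrow> (p, E \<inter> U) of (p, E) \<Rightarrow> (p, E \<union> flips p)) = x"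
    proof
      fix x assume "x \<in> ?K"
      then obtain p E where x: "x = (p, E)" "p permutes {1..n}" "E \<subseteq> {1..n}"
        "\<forall>x\<in>A. signed_perm p E x = x" by blast
      then have "E \<inter> R = flips p" using fixes_iff by blast
      then have "E \<inter> U \<union> flips p = E" using x(3) by (auto simp: U_def)
      then show "(case case x of (p, E) \<Rightarrow> (p, E \<inter> U) of (p, E) \<Rightarrow> (p, E \<union> flips p)) = x"
        using x(1) by simp
    qed
    show "(\<lambda>(p, E). (p, E \<union> flips p)) ` (Q \<times> Pow U) \<subseteq> ?K"
    proof (rule image_subsetI)
      fix x assume "x \<in> Q \<times> Pow U"
      then obtain p E where x: "x = (p, E)" "p \<in> Q" "E \<subseteq> U" by auto
      have "flips p \<subseteq> R" by (auto simp: flips_def)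
      then have "(E \<union> flips p) \<inter> R = flips p" "E \<union> flips p \<subseteq> {1..n}"
        using R x(3) unfolding U_def by blast+
      moreover have "p permutes {1..n}" using x(2) by (simp add: Q_def)
      ultimately show "(case x of (p, E) \<Rightarrow> (p, E \<union> flips p)) \<in> ?K"
        using fixes_iff x by simp
    qed
    show "(\<lambda>(p, E). (p, E \<inter> U)) ` ?K \<subseteq> Q \<times> Pow U" using fixes_iff by auto
  qed
  then have "card ?K = card (Q \<times> Pow U)" by (simp add: bij_betw_same_card)
  also have "\<dots> = card Q * 2 ^ card U" by (simp add: card_cartesian_product card_Pow U_def)
  also have "card U = n - r"
    using R card_Union_supp[OF t] r
    by (simp add: U_def card_Diff_subset finite_subset R_def[symmetric])
  also have "card Q = fact (n - r) * (\<Prod>i=1..n. fact i ^ t i)"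
    unfolding Q_def by (rule card_block_permutations[OF t r])
  finally show ?thesis by (simp add: mult_ac)
qed

end

theorem mainTheorem2:
  fixes n r :: nat and A :: "signed_set set" and t :: "nat \<Rightarrow> nat"
  assumes "n \<ge> 1"
    and "MR_subalgebra n A"
    and "has_type n A t"
    and "r = (\<Sum>i=1..n. i * t i)"
  shows "order (Fr n A) = 2 ^ (n - r) * fact (n - r) * (\<Prod>i=1..n. fact i ^ t i)"
proof -
  have "A \<subseteq> cube n" using assms(2) by (simp add: MR_subalgebra_def)
  then show ?thesis
    using order_Fr_eq_card_signed_perms card_fixing_signed_perms[OF assms(2-4)] by simp
qed

end
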